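(* Consider the $d$-dimensional sandpile model on $\mathbb{Z}^d$ with background height $h=2d-2$. For every $n$ there is an $r_n$ such that $$\mathcal{T}_n=\mathfrak{C}(r_n)\qquad\text{and}\qquad \mathcal{V}_n=\mathfrak{C}(r_n)\cup\partial\mathfrak{C}(r_n).$$ For all $n$, this $r_n$ satisfies $$\tfrac12 n^{1/d}-\tfrac32\le r_n\le n .$$
   Context: Sandpile model with background height $h\le 2d-2$ on $\mathbb{Z}^d$, started with $n$ particles at the origin: a configuration has a particle function $H:\mathbb{Z}^d\to\mathbb{Z}$ and a toppling function $T:\mathbb{Z}^d\to\mathbb{Z}$. Initially $H_0(\mathbf 0)=n$, $H_0(\mathbf x)=h$ for $\mathbf x\ne\mathbf 0$, and $T_0\equiv 0$. A toppling of site $\mathbf x$ increases $T(\mathbf x)$ by $1$, decreases $H(\mathbf x)$ by $2d$ and increases $H$ by $1$ at each of the $2d$ nearest neighbors of $\mathbf x$. It is legal if $H(\mathbf x)\ge 0$ after the toppling. A site is stable if $H(\mathbf x)\le 2d-1$. Performing legal topplings until all sites are stable takes finitely many topplings, and the final configuration $(H_n,T_n)$ does not depend on the order of the topplings. For $\mathbf x\in\mathbb{Z}^d$ let $\mathbf x^\square=\mathbf x+[-\frac12,\frac12]^d$. The toppling cluster is $\mathcal{T}_n=\bigcup_{\mathbf x:T_n(\mathbf x)>0}\mathbf x^\square$ and the particle cluster is $\mathcal{V}_n=\mathcal{T}_n\cup\bigcup_{\mathbf x:H_n(\mathbf x)>h}\mathbf x^\square$. The cube is $\mathfrak{C}(r)=\bigcup_{\mathbf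 x\in\mathbb{Z}^d:\max_i|x_i|\le r}\mathbf x^\square$. For a union $A$ of such unit cubes, $\partial A$ is its exterior boundary: the union of $\mathbf x^\square$ over lattice sites $\mathbf x$ that do not belong to $A$ but have a nearest neighbor in $A$.
   Formalization: The equation for V_n is claimed only for n ≠ 2d−1: at n = 2d−1 no site topples, so T_n and C(r_n) are empty, yet V_n is the unit cube at the origin. The T_n equation and both bounds hold for all n; r_n is real, an integer whenever r_n ≥ 0. *)

theory Defs
  imports "HOL-Analysis.Analysis"
begin

text \<open>
  Sites of the lattice are elements of \<open>int ^ 'd\<close>, so that the dimension is \<open>CARD('d) \<ge> 1\<close>.
  A configuration is the pair \<open>(H, T)\<close> of its particle function and its toppling function.
\<close>

type_synonym 'd config = "(int ^ 'd \<Rightarrow> int) \<times> (int ^ 'd \<Rightarrow> int)"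

definition nearest_neighbor :: "int ^ 'd \<Rightarrow> int ^ 'd \<Rightarrow> bool" where
  "nearest_neighbor x y \<longleftrightarrow> (\<Sum>i\<in>UNIV. \<bar>x $ i - y $ i\<bar>) = 1"

text \<open>There are \<open>n\<close> particles at the origin, not \<open>h + n\<close>.\<close>

definition initial_config :: "int \<Rightarrow> nat \<Rightarrow> ('d::finite) config" where
  "initial_config h n = ((\<lambda>x. if x = 0 then int n else h), (\<lambda>x. 0))"

definition topple :: "int ^ 'd \<Rightarrow> 'd config \<Rightarrow> 'd config" where
  "topple x c =
    ((\<lambda>y. if y = x then fst c y - 2 * int CARD('d)
          else if nearest_neighbor x y then fst c y + 1
          else fst c y),
     (snd c)(x := snd c x + 1))"

definition legal_toppling :: "('d::finite) config \<Rightarrow> 'd config \<Rightarrow> bool" where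
  "legal_toppling c c' \<longleftrightarrow> (\<exists>x. c' = topple x c \<and> fst c' x \<ge> 0)"

definition stable :: "('d::finite) config \<Rightarrow> bool" where
  "stable c \<longleftrightarrow> (\<forall>x. fst c x \<le> 2 * int CARD('d) - 1)"

text \<open>
  The final configuration is the stable configuration reached by finitely many legal topplings.
  It exists and is unique for \<open>0 \<le> h \<le> 2 * CARD('d) - 2\<close>, which is the only case of interest.
\<close>

definition final_config :: "int \<Rightarrow> nat \<Rightarrow> ('d::finite) config" where
  "final_config h n = (THE c. legal_toppling\<^sup>*\<^sup>* (initial_config h n) c \<and> stable c)"

definition final_particles :: "int \<Rightarrow> nat \<Rightarrow> int ^ 'd \<Rightarrow> int" where
  "final_particles h n = fst (final_config h n)"

definition final_topplings :: "int \<Rightarrow> nat \<Rightarrow> int ^ 'd \<Rightarrow> int" where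
  "final_topplings h n = snd (final_config h n)"

definition lattice_point :: "int ^ 'd \<Rightarrow> real ^ 'd" where
  "lattice_point x = (\<chi> i. real_of_int (x $ i))"

definition unit_cube :: "int ^ 'd \<Rightarrow> (real ^ 'd) set" where
  "unit_cube x = {y. \<forall>i. y $ i - real_of_int (x $ i) \<in> {- 1/2 .. 1/2}}"

definition toppling_cluster :: "int \<Rightarrow> nat \<Rightarrow> (real ^ 'd) set" where
  "toppling_cluster h n = (\<Union>x\<in>{x. final_topplings h n x > 0}. unit_cube x)"

definition particle_cluster :: "int \<Rightarrow> nat \<Rightarrow> (real ^ 'd) set" where
  "particle_cluster h n =
     toppling_cluster h n \<union> (\<Union>x\<in>{x. final_particles h n x > h}. unit_cube x)"

text \<open>The radius is real; the cube is empty exactly for negative radius.\<close>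

definition lattice_cube :: "real \<Rightarrow> (real ^ 'd) set" where
  "lattice_cube r =
     (\<Union>x\<in>{x :: int ^ 'd. real_of_int (MAX i\<in>UNIV. \<bar>x $ i\<bar>) \<le> r}. unit_cube x)"

definition exterior_boundary :: "(real ^ 'd) set \<Rightarrow> (real ^ 'd) set" where
  "exterior_boundary A =
     (\<Union>x\<in>{x. lattice_point x \<notin> A \<and> (\<exists>y. nearest_neighbor x y \<and> lattice_point y \<in> A)}.
        unit_cube x)"

end

theory Submission
  imports Defs
begin

text \<open>
  A legal toppling sequence topples no site more often than any nonnegative function \<open>w\<close> for which
  \<open>H\<^sub>0 + \<Delta> w\<close> is stable (least action). The sum of the pyramids \<open>max (j - \<parallel>x\<parallel>) 0\<close> for
  \<open>1 \<le> j \<le> n\<close>, with the maximum norm, is such a function, because away from the origin its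
  Laplacian is at most 1. This gives the final configuration and the bound \<open>r\<^sub>n \<le> n\<close>.

  For background \<open>2d - 2\<close> a site that never topples, other than the origin, has at most one toppled
  neighbor. The toppled set is also connected and invariant under the symmetries of the cube. Hence
  it contains the whole cube of radius \<open>k + 1\<close> as soon as it contains the cube of radius \<open>k\<close> and
  one site just outside: this site spreads over its face, symmetry gives all faces, and sites with
  several extremal coordinates have several toppled neighbors.

  The lower bound counts the particles in the cube of radius \<open>r + 1\<close>, outside of which nothing
  changes.
\<close>

section \<open>The lattice\<close>

definition sup_norm :: "int ^ 'd::finite \<Rightarrow> int" where
  "sup_norm x = (MAX i\<in>UNIV. \<bar>x $ i\<bar>)"

lemma sup_norm_le_iff: "sup_norm x \<le> k \<longleftrightarrow> (\<forall>i. \<bar>x $ i\<bar> \<le> k)"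
  unfolding sup_norm_def by (subst Max_le_iff) auto

lemma component_le_sup_norm: "\<bar>x $ i\<bar> \<le> sup_norm x"
  using sup_norm_le_iff[of x "sup_norm x"] by simp

lemma sup_norm_attained: "\<exists>i. \<bar>x $ i\<bar> = sup_norm x"
proof -
  have "sup_norm x \<in> range (\<lambda>i. \<bar>x $ i\<bar>)"
    unfolding sup_norm_def by (rule Max_in) auto
  then show ?thesis by auto
qed

lemma sup_norm_nonneg: "0 \<le> sup_norm x"
  using component_le_sup_norm[of x undefined] by linarith

lemma sup_norm_0 [simp]: "sup_norm 0 = 0"
  by (rule antisym) (simp_all add: sup_norm_le_iff sup_norm_nonneg)

lemma sup_norm_le_0_iff: "sup_norm x \<le> 0 \<longleftrightarrow> x = 0"
  by (auto simp: sup_norm_le_iff vec_eq_iff)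

text \<open>Extensionality is vacuous on \<open>UNIV\<close>, so vectors inherit the cardinality and
  finiteness results for \<open>PiE\<close>.\<close>

lemma bij_betw_vec_nth: "bij_betw vec_nth {x :: int ^ 'd::finite. \<forall>i. x $ i \<in> A} (UNIV \<rightarrow>\<^sub>E A)"
  by (rule bij_betw_byWitness[where f' = vec_lambda]) (auto simp: PiE_def)

lemma card_vec_components_in:
  "card {x :: int ^ 'd::finite. \<forall>i. x $ i \<in> A} = card A ^ CARD('d)"
  using bij_betw_same_card[OF bij_betw_vec_nth[of A]] by (simp add: card_PiE)

lemma finite_vec_components_in:
  assumes "finite A"
  shows "finite {x :: int ^ 'd::finite. \<forall>i. x $ i \<in> A}"
  using bij_betw_finite[OF bij_betw_vec_nth[of A]] assms by (simp add: finite_PiE)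

lemma sup_norm_ball_eq: "{x. sup_norm x \<le> k} = {x. \<forall>i. x $ i \<in> {-k..k}}"
  by (auto simp: sup_norm_le_iff abs_le_iff minus_le_iff)

lemma finite_sup_norm_ball: "finite {x. sup_norm x \<le> k}"
  unfolding sup_norm_ball_eq by (rule finite_vec_components_in) simp

lemma card_sup_norm_ball:
  assumes "0 \<le> k"
  shows "int (card {x :: int ^ 'd::finite. sup_norm x \<le> k}) = (2 * k + 1) ^ CARD('d)"
  unfolding sup_norm_ball_eq card_vec_components_in using assms by simp

section \<open>Nearest neighbors and sums over them\<close>

lemma nearest_neighbor_sym: "nearest_neighbor x y \<longleftrightarrow> nearest_neighbor y x"
  by (simp add: nearest_neighbor_def abs_minus_commute)

lemma not_nearest_neighbor_self [simp]: "\<not> nearest_neighbor x x"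
  by (simp add: nearest_neighbor_def)

lemma nearest_neighbor_axis:
  assumes "\<bar>s\<bar> = 1"
  shows "nearest_neighbor x (x + axis i s)"
proof -
  have "(\<Sum>j\<in>UNIV. \<bar>x $ j - (x + axis i s) $ j\<bar>) = (\<Sum>j\<in>UNIV. if j = i then 1 else 0)"
    using assms by (intro sum.cong) (auto simp: axis_def)
  then show ?thesis by (simp add: nearest_neighbor_def)
qed

text \<open>A nonzero integer difference in one coordinate already uses up the whole distance
  1.\<close>

lemma nearest_neighbor_iff:
  "nearest_neighbor x y \<longleftrightarrow> (\<exists>i. \<exists>s\<in>{1, -1}. y = x + axis i s)"
proof
  assume nn: "nearest_neighbor x y"
  then have sum1: "(\<Sum>j\<in>UNIV. \<bar>x $ j - y $ j\<bar>) = 1" by (simp add: nearest_neighbor_def)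
  then obtain i where "x $ i \<noteq> y $ i"
    by (metis (no_types, lifting) abs_0 diff_self sum.neutral zero_neq_one)
  then have "\<bar>x $ i - y $ i\<bar> \<ge> 1" by linarith
  moreover have "(\<Sum>j\<in>UNIV. \<bar>x $ j - y $ j\<bar>)
      = \<bar>x $ i - y $ i\<bar> + (\<Sum>j\<in>UNIV - {i}. \<bar>x $ j - y $ j\<bar>)"
    by (rule sum.remove) auto
  moreover have "(\<Sum>j\<in>UNIV - {i}. \<bar>x $ j - y $ j\<bar>) \<ge> 0" by (rule sum_nonneg) simp
  ultimately have i1: "\<bar>x $ i - y $ i\<bar> = 1"
    and "(\<Sum>j\<in>UNIV - {i}. \<bar>x $ j - y $ j\<bar>) = 0" using sum1 by linarith+
  then have "\<forall>j\<in>UNIV - {i}. x $ j = y $ j" by (subst (asm) sum_nonneg_eq_0_iff) auto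
  then have "y = x + axis i (y $ i - x $ i)" by (auto simp: vec_eq_iff axis_def)
  moreover have "y $ i - x $ i \<in> {1, -1}" using i1 by auto
  ultimately show "\<exists>i. \<exists>s\<in>{1, -1}. y = x + axis i s" by blast
qed (auto intro: nearest_neighbor_axis)

lemma neighbors_bij:
  "bij_betw (\<lambda>(i, s). x + axis i s) (UNIV \<times> {1, -1 :: int}) {y. nearest_neighbor x y}"
  unfolding bij_betw_def
proof
  show "inj_on (\<lambda>(i, s). x + axis i s) (UNIV \<times> {1, -1})"
    by (auto simp: inj_on_def axis_eq_axis)
qed (auto simp: nearest_neighbor_iff image_iff)

lemma finite_neighbors [simp]: "finite {y. nearest_neighbor x y}"
  using bij_betw_finite[OF neighbors_bij] by auto

lemma sum_neighbors:
  fixes f :: "int ^ 'd::finite \<Rightarrow> int"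
  shows "(\<Sum>y | nearest_neighbor x y. f y) = (\<Sum>i\<in>UNIV. f (x + axis i 1) + f (x + axis i (-1)))"
proof -
  have "(\<Sum>y | nearest_neighbor x y. f y) = (\<Sum>(i, s)\<in>UNIV \<times> {1, -1}. f (x + axis i s))"
    using sum.reindex_bij_betw[OF neighbors_bij, of f x] by (simp add: case_prod_unfold)
  also have "\<dots> = (\<Sum>i\<in>UNIV. \<Sum>s\<in>{1, -1}. f (x + axis i s))"
    by (rule sum.cartesian_product[symmetric])
  finally show ?thesis by simp
qed

lemma neighbor_component_diff:
  assumes "nearest_neighbor x y"
  shows "\<bar>x $ i - y $ i\<bar> \<le> 1"
  using assms by (auto simp: nearest_neighbor_iff axis_def)

lemma sup_norm_neighbor:
  assumes "nearest_neighbor x y"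
  shows "sup_norm x \<le> sup_norm y + 1"
proof -
  have "\<bar>x $ i\<bar> \<le> sup_norm y + 1" for i
    using neighbor_component_diff[OF assms, of i] component_le_sup_norm[of y i] by linarith
  then show ?thesis by (simp add: sup_norm_le_iff)
qed

section \<open>Abelian property\<close>

definition laplacian :: "(int ^ 'd::finite \<Rightarrow> int) \<Rightarrow> int ^ 'd \<Rightarrow> int" where
  "laplacian T x = (\<Sum>y | nearest_neighbor x y. T y) - 2 * int CARD('d) * T x"

lemma laplacian_eq:
  "laplacian T x = (\<Sum>i\<in>UNIV. T (x + axis i 1) + T (x + axis i (-1)) - 2 * T x)"
  by (simp add: laplacian_def sum_neighbors sum_subtractf)

text \<open>The added term is exactly what one toppling of \<open>x\<close> does to the particle
  function.\<close>

lemma laplacian_upd: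
  "laplacian (T(x := T x + 1)) y = laplacian T y +
     (if y = x then - 2 * int CARD('d) else if nearest_neighbor x y then 1 else 0)"
  for T :: "int ^ 'd::finite \<Rightarrow> int"
proof -
  have "(\<Sum>z | nearest_neighbor y z. (T(x := T x + 1)) z)
      = (\<Sum>z | nearest_neighbor y z. T z + (if z = x then 1 else 0))"
    by (rule sum.cong) auto
  also have "\<dots> = (\<Sum>z | nearest_neighbor y z. T z) + (if nearest_neighbor y x then 1 else 0)"
    by (simp add: sum.distrib)
  finally show ?thesis
    by (auto simp: laplacian_def nearest_neighbor_sym[of y x] algebra_simps)
qed

text \<open>Conservation of particles: \<open>T\<close> and its two translates along an axis have
  the same total over the larger cube, so the second differences cancel.\<close>

lemma sum_laplacian_eq_0:
  fixes T :: "int ^ 'd::finite \<Rightarrow> int"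
  assumes "\<And>x. T x \<noteq> 0 \<Longrightarrow> sup_norm x \<le> k"
  shows "(\<Sum>x | sup_norm x \<le> k + 1. laplacian T x) = 0"
proof -
  let ?C = "{x :: int ^ 'd. sup_norm x \<le> k + 1}" and ?B = "{x :: int ^ 'd. sup_norm x \<le> k}"
  \<comment> \<open>A unit translate moves the support by at most one layer, and the cube of radius
    \<open>k + 1\<close> still contains it.\<close>
  have shift: "(\<Sum>x\<in>?C. T (x + axis i s)) = sum T ?B" if "\<bar>s\<bar> \<le> 1" for i s
  proof -
    have "(\<Sum>x\<in>?C. T (x + axis i s)) = sum T ((\<lambda>x. x + axis i s) ` ?C)"
      by (subst sum.reindex) (auto simp: inj_on_def)
    also have "\<dots> = sum T ?B"
    proof (rule sum.mono_neutral_right)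
      show "?B \<subseteq> (\<lambda>x. x + axis i s) ` ?C"
      proof
        fix x assume "x \<in> ?B"
        then have "\<bar>x $ j\<bar> \<le> k" for j by (simp add: sup_norm_le_iff)
        moreover have "\<bar>axis i s $ j\<bar> \<le> 1" for j using that by (simp add: axis_def)
        ultimately have "\<bar>(x - axis i s) $ j\<bar> \<le> k + 1" for j
          unfolding vector_minus_component by (meson abs_triangle_ineq4 add_mono order_trans)
        then have "x - axis i s \<in> ?C" by (simp add: sup_norm_le_iff)
        then show "x \<in> (\<lambda>x. x + axis i s) ` ?C" by (rule rev_image_eqI) simp
      qed
    qed (use assms in \<open>auto simp: finite_sup_norm_ball\<close>)
    finally show ?thesis .
  qed
  have "sum T ?C = sum T ?B"
    by (rule sum.mono_neutral_right) (use assms in \<open>auto simp: finite_sup_norm_ball\<close>)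
  then have "(\<Sum>x\<in>?C. T (x + axis i 1) + T (x + axis i (-1)) - 2 * T x) = 0" for i
    using shift[of 1 i] shift[of "-1" i] by (simp add: sum.distrib sum_subtractf flip: sum_distrib_left)
  then show ?thesis
    unfolding laplacian_eq by (subst sum.swap) simp
qed

text \<open>The site loses 2d particles, so nonnegativity afterwards means instability
  before.\<close>

lemma legal_toppling_iff:
  "legal_toppling c c' \<longleftrightarrow> (\<exists>x. c' = topple x c \<and> fst c x \<ge> 2 * int CARD('d))"
  for c :: "('d::finite) config"
  by (auto simp: legal_toppling_def topple_def)

lemma reachable_invariant:
  assumes "legal_toppling\<^sup>*\<^sup>* (H0, \<lambda>_. 0) c"
  shows "fst c = (\<lambda>x. H0 x + laplacian (snd c) x) \<and> (\<forall>x. 0 \<le> snd c x)"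
  using assms
proof (induction rule: rtranclp_induct)
  case base
  then show ?case by (simp add: laplacian_def)
next
  case (step c c')
  then obtain x where "c' = topple x c" by (auto simp: legal_toppling_def)
  then have "fst c' y = fst c y + (laplacian (snd c') y - laplacian (snd c) y)"
    and "snd c y \<le> snd c' y" for y
    using laplacian_upd[of "snd c" x y] by (auto simp: topple_def simp del: fun_upd_apply) (simp add: topple_def)
  with step.IH show ?case by (auto intro: order_trans)
qed

text \<open>A discrete maximum principle: at a point of contact the central terms agree, and the
  neighboring values of \<open>w\<close> dominate.\<close>

lemma laplacian_mono_at:
  assumes "\<And>y. T y \<le> w y" "T x = w x"
  shows "laplacian T x \<le> laplacian w x"
  unfolding laplacian_def using assms by (auto intro!: sum_mono)

text \<open>The bound could first fail only by toppling a site \<open>z\<close> where the topplings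
  so far equal \<open>w z\<close>. Contact bounds its height by that of
  \<open>H0 + laplacian w\<close>, which is stable, so \<open>z\<close> cannot topple
  legally.\<close>

lemma least_action:
  fixes w :: "int ^ 'd::finite \<Rightarrow> int"
  assumes reach: "legal_toppling\<^sup>*\<^sup>* (H0, \<lambda>_. 0) c"
    and nonneg: "\<And>x. 0 \<le> w x"
    and stab: "\<And>x. H0 x + laplacian w x \<le> 2 * int CARD('d) - 1"
  shows "snd c x \<le> w x"
  using reach
proof (induction arbitrary: x rule: rtranclp_induct)
  case base
  then show ?case using nonneg by simp
next
  case (step c c')
  then obtain z where z: "c' = topple z c" "fst c z \<ge> 2 * int CARD('d)"
    by (auto simp: legal_toppling_iff)
  have "fst c z = H0 z + laplacian (snd c) z"
    using reachable_invariant[OF step.hyps(1)] by simp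
  then have "snd c z \<noteq> w z"
    using laplacian_mono_at[of "snd c" w z] step.IH z(2) stab[of z] by force
  then show ?case using step.IH[of z] step.IH[of x] z(1) by (auto simp: topple_def)
qed

text \<open>Existence: the number of topplings is bounded by the sum of \<open>w\<close>, and a
  reachable configuration with the largest total admits no further toppling. Uniqueness: the
  toppling function of each stable outcome serves as \<open>w\<close> for the other.\<close>

lemma stable_reachable_ex1:
  fixes w :: "int ^ 'd::finite \<Rightarrow> int"
  assumes nonneg: "\<And>x. 0 \<le> w x"
    and stab: "\<And>x. H0 x + laplacian w x \<le> 2 * int CARD('d) - 1"
    and fin: "finite {x. w x \<noteq> 0}"
  shows "\<exists>!c. legal_toppling\<^sup>*\<^sup>* (H0, \<lambda>_. 0) c \<and> stable c"
proof (rule ex_ex1I)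
  let ?reach = "\<lambda>c :: 'd config. legal_toppling\<^sup>*\<^sup>* (H0, \<lambda>_. 0) c"
  let ?S = "{x. w x \<noteq> 0}"
  define total where "total c = nat (\<Sum>x\<in>?S. snd c x)" for c :: "'d config"
  have bound: "total c < Suc (nat (sum w ?S))" if "?reach c" for c
    unfolding total_def less_Suc_eq_le
    by (intro nat_mono sum_mono least_action[OF that nonneg stab])
  then obtain c where c: "?reach c" "\<And>c'. ?reach c' \<Longrightarrow> total c' \<le> total c"
    using ex_has_greatest_nat[of ?reach "(H0, \<lambda>_. 0)" total "Suc (nat (sum w ?S))"]
    by fastforce
  have "stable c"
  proof (rule ccontr)
    assume "\<not> stable c"
    then obtain x where "fst c x \<ge> 2 * int CARD('d)" unfolding stable_def by (metis linorder_not_less zle_diff1_eq)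
    then have "legal_toppling c (topple x c)" by (auto simp: legal_toppling_iff)
    then have r: "?reach (topple x c)" using c(1) by (rule rtranclp.rtrancl_into_rtrancl[rotated])
    have "snd (topple x c) x = snd c x + 1" by (simp add: topple_def)
    moreover have "0 \<le> snd c x" for x using reachable_invariant[OF c(1)] by simp
    \<comment> \<open>A site that topples lies in the support of \<open>w\<close>, so
      \<open>total\<close>, which sums over this support only, registers the toppling.\<close>
    ultimately have "w x \<noteq> 0" "0 \<le> (\<Sum>x\<in>?S. snd c x)"
      using least_action[OF r nonneg stab, of x]
      by (metis add_increasing2 linorder_not_less order_refl zle_add1_eq_le, simp add: sum_nonneg)
    moreover have "(\<Sum>y\<in>?S. snd (topple x c) y) = (\<Sum>y\<in>?S. snd c y + (if y = x then 1 else 0))"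
      by (rule sum.cong) (auto simp: topple_def)
    ultimately have "total (topple x c) = Suc (total c)"
      using fin by (simp add: total_def sum.distrib)
    then show False using c(2)[OF r] by simp
  qed
  with c(1) show "\<exists>c. ?reach c \<and> stable c" by blast
next
  fix c c' :: "'d config"
  assume 1: "legal_toppling\<^sup>*\<^sup>* (H0, \<lambda>_. 0) c \<and> stable c"
    and 2: "legal_toppling\<^sup>*\<^sup>* (H0, \<lambda>_. 0) c' \<and> stable c'"
  note i1 = reachable_invariant[OF conjunct1[OF 1]] and i2 = reachable_invariant[OF conjunct1[OF 2]]
  have "snd c x \<le> snd c' x" for x
    by (rule least_action[OF conjunct1[OF 1]]) (use 2 i2 in \<open>auto simp: stable_def\<close>)
  moreover have "snd c' x \<le> snd c x" for x
    by (rule least_action[OF conjunct1[OF 2]]) (use 1 i1 in \<open>auto simp: stable_def\<close>)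
  ultimately have "snd c = snd c'" by (intro ext antisym)
  with i1 i2 show "c = c'" by (auto simp: prod_eq_iff)
qed

section \<open>Invariance under lattice symmetries\<close>

lemma laplacian_involution:
  assumes inv: "\<And>x. \<sigma> (\<sigma> x) = x"
    and nn: "\<And>x y. nearest_neighbor (\<sigma> x) (\<sigma> y) \<longleftrightarrow> nearest_neighbor x y"
  shows "laplacian (\<lambda>x. T (\<sigma> x)) x = laplacian T (\<sigma> x)"
proof -
  have "bij_betw \<sigma> {y. nearest_neighbor x y} {y. nearest_neighbor (\<sigma> x) y}"
    by (rule bij_betw_byWitness[where f' = \<sigma>]) (auto simp: inv nn, metis inv nn)
  from sum.reindex_bij_betw[OF this, of T] show ?thesis by (simp add: laplacian_def)
qed

text \<open>The toppling function composed with the symmetry stabilizes \<open>H0\<close> as well,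
  so least action gives one inequality; evaluated at \<open>\<sigma> x\<close> it gives the
  other.\<close>

lemma topplings_involution:
  fixes c :: "('d::finite) config"
  assumes reach: "legal_toppling\<^sup>*\<^sup>* (H0, \<lambda>_. 0) c" and "stable c"
    and inv: "\<And>x. \<sigma> (\<sigma> x) = x"
    and nn: "\<And>x y. nearest_neighbor (\<sigma> x) (\<sigma> y) \<longleftrightarrow> nearest_neighbor x y"
    and H0: "\<And>x. H0 (\<sigma> x) = H0 x"
  shows "snd c (\<sigma> x) = snd c x"
proof -
  note i = reachable_invariant[OF reach]
  have "snd c x \<le> snd c (\<sigma> x)" for x
  proof (rule least_action[OF reach])
    fix x
    have "H0 x + laplacian (\<lambda>x. snd c (\<sigma> x)) x = fst c (\<sigma> x)"
      using i by (simp add: laplacian_involution[OF inv nn] H0)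
    then show "H0 x + laplacian (\<lambda>x. snd c (\<sigma> x)) x \<le> 2 * int CARD('d) - 1"
      using \<open>stable c\<close> by (simp add: stable_def)
  qed (use i in simp)
  from this[of x] this[of "\<sigma> x"] show ?thesis by (simp add: inv)
qed

section \<open>Stabilization\<close>

text \<open>For m between 0 and n the value is (n - m)(n - m + 1)/2, and 0 beyond n. The sum form
  lets differences be taken term by term.\<close>

definition pyramid :: "nat \<Rightarrow> int \<Rightarrow> int" where
  "pyramid n m = (\<Sum>j\<in>{1..int n}. max (j - m) 0)"

lemma pyramid_nonneg: "0 \<le> pyramid n m"
  by (simp add: pyramid_def sum_nonneg)

lemma pyramid_antimono: "m \<le> m' \<Longrightarrow> pyramid n m' \<le> pyramid n m"
  unfolding pyramid_def by (rule sum_mono) auto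

lemma pyramid_eq_0: "int n \<le> m \<Longrightarrow> pyramid n m = 0"
  unfolding pyramid_def by (rule sum.neutral) auto

text \<open>Each summand is piecewise linear in \<open>m\<close> with a single kink, at
  \<open>m = j\<close>, where the slope changes by 1.\<close>

lemma pyramid_second_difference: "pyramid n (m + 1) + pyramid n (m - 1) - 2 * pyramid n m \<le> 1"
proof -
  have "pyramid n (m + 1) + pyramid n (m - 1) - 2 * pyramid n m
      = (\<Sum>j\<in>{1..int n}. max (j - (m + 1)) 0 + max (j - (m - 1)) 0 - 2 * max (j - m) 0)"
    by (simp add: pyramid_def sum.distrib sum_subtractf sum_distrib_left)
  also have "\<dots> = (\<Sum>j\<in>{1..int n}. if j = m then 1 else 0)"
    by (rule sum.cong) (auto simp: max_def)
  also have "\<dots> \<le> 1" by simp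
  finally show ?thesis .
qed

text \<open>Every summand drops by one. This drop makes the Laplacian at the origin negative enough
  to absorb the \<open>n\<close> particles.\<close>

lemma pyramid_first_difference: "pyramid n 1 = pyramid n 0 - int n"
proof -
  have "pyramid n 0 - pyramid n 1 = (\<Sum>j\<in>{1..int n}. max (j - 0) 0 - max (j - 1) 0)"
    by (simp add: pyramid_def sum_subtractf)
  also have "\<dots> = (\<Sum>j\<in>{1..int n}. 1)" by (rule sum.cong) auto
  finally show ?thesis by simp
qed

text \<open>Fix a coordinate \<open>i\<close> that attains the norm. Moves along other axes cannot
  decrease the norm, so only the axis \<open>i\<close> can contribute positively, by a
  one-dimensional second difference.\<close>

lemma laplacian_pyramid_le_1:
  fixes x :: "int ^ 'd::finite"
  assumes "x \<noteq> 0"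
  shows "laplacian (\<lambda>x. pyramid n (sup_norm x)) x \<le> 1"
proof -
  let ?w = "\<lambda>x :: int ^ 'd. pyramid n (sup_norm x)"
  let ?f = "\<lambda>i. ?w (x + axis i 1) + ?w (x + axis i (-1)) - 2 * ?w x"
  obtain i where i: "\<bar>x $ i\<bar> = sup_norm x" using sup_norm_attained by blast
  have "sup_norm x \<ge> 1" using assms sup_norm_le_0_iff[of x] by linarith
  have "?f j \<le> 0" if "j \<noteq> i" for j
  proof -
    have "?w (x + axis j s) \<le> ?w x" for s
      using component_le_sup_norm[of "x + axis j s" i] i that
      by (intro pyramid_antimono) (simp add: axis_def)
    from this[of 1] this[of "-1"] show ?thesis by linarith
  qed
  then have "(\<Sum>j\<in>UNIV - {i}. ?f j) \<le> 0" by (intro sum_nonpos) simp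
  moreover have "?f i \<le> 1"
  proof -
    define s where "s = sgn (x $ i)"
    have s: "s = 1 \<or> s = -1" "\<bar>x $ i + s\<bar> = sup_norm x + 1" "\<bar>x $ i - s\<bar> = sup_norm x - 1"
      using i \<open>sup_norm x \<ge> 1\<close> by (auto simp: s_def sgn_if)
    have "?w (x + axis i s) \<le> pyramid n (sup_norm x + 1)"
      using component_le_sup_norm[of "x + axis i s" i] s(2)
      by (intro pyramid_antimono) (simp add: axis_def)
    moreover have "?w (x + axis i (- s)) \<le> pyramid n (sup_norm x - 1)"
      using component_le_sup_norm[of "x + axis i (- s)" i] s(3)
      by (intro pyramid_antimono) (simp add: axis_def)
    ultimately have "?w (x + axis i s) + ?w (x + axis i (- s)) - 2 * ?w x \<le> 1"
      using pyramid_second_difference[of n "sup_norm x"] by linarith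
    then show ?thesis using s(1) by auto
  qed
  moreover have "(\<Sum>j\<in>UNIV. ?f j) = ?f i + (\<Sum>j\<in>UNIV - {i}. ?f j)"
    by (rule sum.remove) auto
  ultimately show ?thesis unfolding laplacian_eq by linarith
qed

lemma laplacian_pyramid_0:
  "laplacian (\<lambda>x :: int ^ 'd::finite. pyramid n (sup_norm x)) 0 = - 2 * int CARD('d) * int n"
proof -
  have "sup_norm (axis i s :: int ^ 'd) = 1" if "\<bar>s\<bar> = 1" for i s
  proof (rule antisym)
    show "sup_norm (axis i s :: int ^ 'd) \<le> 1" using that by (auto simp: sup_norm_le_iff axis_def)
    show "1 \<le> sup_norm (axis i s :: int ^ 'd)"
      using component_le_sup_norm[of "axis i s" i] that by (simp add: axis_def)
  qed
  then show ?thesis by (simp add: laplacian_eq pyramid_first_difference)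
qed

text \<open>At the origin the loss of 2dn leaves at most 0; elsewhere the background 2d - 2 rises by
  at most one.\<close>

lemma initial_pyramid_stable:
  fixes x :: "int ^ 'd::finite"
  assumes "h = 2 * int CARD('d) - 2"
  shows "fst (initial_config h n) x + laplacian (\<lambda>x. pyramid n (sup_norm x)) x
           \<le> 2 * int CARD('d) - 1"
proof (cases "x = 0")
  case True
  have "int n * 1 \<le> int n * (2 * int CARD('d))" using zero_less_card_finite[where 'a = 'd]
    by (intro mult_left_mono) linarith+
  moreover have "int CARD('d) \<ge> 1" using zero_less_card_finite[where 'a = 'd] by linarith
  ultimately have "int n - 2 * int CARD('d) * int n \<le> 2 * int CARD('d) - 1"
    by (simp only: mult.commute[of "int n"] mult_1_left)
  then show ?thesis using True by (simp add: laplacian_pyramid_0 initial_config_def)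
qed (use laplacian_pyramid_le_1[of x n] assms in \<open>auto simp: initial_config_def\<close>)

lemma initial_config_eq: "initial_config h n = (fst (initial_config h n), \<lambda>_. 0)"
  by (simp add: initial_config_def)

text \<open>The pyramid is the finitely supported function for \<open>stable_reachable_ex1\<close>,
  so the description in \<open>final_config\<close> is proper. Least action then bounds the
  topplings.\<close>

lemma
  assumes "h = 2 * int CARD('d::finite) - 2"
  shows final_config_reachable: "legal_toppling\<^sup>*\<^sup>* (initial_config h n) (final_config h n :: 'd config)"
    and final_config_stable: "stable (final_config h n :: 'd config)"
    and final_topplings_le: "final_topplings h n (x :: int ^ 'd) \<le> pyramid n (sup_norm x)"
proof -
  let ?w = "\<lambda>x :: int ^ 'd. pyramid n (sup_norm x)"
  have "sup_norm x \<le> int n" if "?w x \<noteq> 0" for x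
    using pyramid_eq_0[of n "sup_norm x"] that by linarith
  then have "{x. ?w x \<noteq> 0} \<subseteq> {x. sup_norm x \<le> int n}" by blast
  then have "finite {x. ?w x \<noteq> 0}" using finite_sup_norm_ball finite_subset by blast
  from stable_reachable_ex1[OF pyramid_nonneg initial_pyramid_stable[OF assms] this]
  have "\<exists>!c :: 'd config. legal_toppling\<^sup>*\<^sup>* (initial_config h n) c \<and> stable c"
    unfolding initial_config_eq[symmetric] .
  from theI'[OF this]
  show r: "legal_toppling\<^sup>*\<^sup>* (initial_config h n) (final_config h n :: 'd config)"
    and "stable (final_config h n :: 'd config)"
    by (auto simp: final_config_def)
  show "final_topplings h n x \<le> pyramid n (sup_norm x)"
    unfolding final_topplings_def
    by (rule least_action[OF _ pyramid_nonneg initial_pyramid_stable[OF assms]])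
      (unfold initial_config_eq[symmetric], rule r)
qed

section \<open>Closed symmetric sets are cubes\<close>

text \<open>Reflections and, below, swaps of coordinates generate the symmetry group of the cube.
  Both are involutions, as \<open>topplings_involution\<close> requires.\<close>

definition flip :: "'d \<Rightarrow> int ^ 'd::finite \<Rightarrow> int ^ 'd" where
  "flip i x = (\<chi> j. if j = i then - x $ j else x $ j)"

definition swap_coords :: "'d \<Rightarrow> 'd \<Rightarrow> int ^ 'd::finite \<Rightarrow> int ^ 'd" where
  "swap_coords i j x = (\<chi> k. x $ (Transposition.transpose i j k))"

lemma flip_flip [simp]: "flip i (flip i x) = x"
  by (simp add: flip_def vec_eq_iff)

lemma swap_coords_swap_coords [simp]: "swap_coords i j (swap_coords i j x) = x"
  by (simp add: swap_coords_def vec_eq_iff)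

lemma nearest_neighbor_flip: "nearest_neighbor (flip i x) (flip i y) \<longleftrightarrow> nearest_neighbor x y"
proof -
  have "\<bar>flip i x $ j - flip i y $ j\<bar> = \<bar>x $ j - y $ j\<bar>" for j
    by (simp add: flip_def abs_minus_commute)
  then show ?thesis by (simp add: nearest_neighbor_def)
qed

lemma nearest_neighbor_swap_coords:
  "nearest_neighbor (swap_coords i j x) (swap_coords i j y) \<longleftrightarrow> nearest_neighbor x y"
proof -
  have "(\<Sum>k\<in>UNIV. \<bar>swap_coords i j x $ k - swap_coords i j y $ k\<bar>) = (\<Sum>k\<in>UNIV. \<bar>x $ k - y $ k\<bar>)"
    unfolding swap_coords_def vec_lambda_beta
    using sum.reindex_bij_betw[of "Transposition.transpose i j" UNIV UNIV "\<lambda>k. \<bar>x $ k - y $ k\<bar>"]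
    by simp
  then show ?thesis by (simp add: nearest_neighbor_def)
qed

text \<open>The axiom \<open>closed\<close> makes \<open>S\<close> stationary for bootstrap
  percolation with threshold two.\<close>

locale symmetric_closed_set =
  fixes S :: "(int ^ 'd::finite) set"
  assumes closed: "\<And>x y z. \<lbrakk>nearest_neighbor x y; nearest_neighbor x z; y \<noteq> z; y \<in> S; z \<in> S\<rbrakk> \<Longrightarrow> x \<in> S"
    and flip: "\<And>i x. x \<in> S \<Longrightarrow> flip i x \<in> S"
    and swap: "\<And>i j x. x \<in> S \<Longrightarrow> swap_coords i j x \<in> S"
begin

text \<open>Induction on the distance to \<open>x\<close>. A site \<open>z\<close> of the face has
  two neighbors in \<open>S\<close>: one a step closer to \<open>x\<close> along the face, one a
  step inward in the smaller cube.\<close>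

lemma fill_face:
  assumes cube: "\<And>x. sup_norm x \<le> k \<Longrightarrow> x \<in> S"
    and x: "x \<in> S" "\<bar>x $ i\<bar> = k + 1" "\<And>j. j \<noteq> i \<Longrightarrow> \<bar>x $ j\<bar> \<le> k" and "0 \<le> k"
    and z: "z $ i = x $ i" "\<And>j. j \<noteq> i \<Longrightarrow> \<bar>z $ j\<bar> \<le> k"
  shows "z \<in> S"
  using z
proof (induction "nat (\<Sum>j\<in>UNIV. \<bar>z $ j - x $ j\<bar>)" arbitrary: z rule: less_induct)
  case less
  show ?case
  proof (cases "z = x")
    case False
    then obtain j where j: "z $ j \<noteq> x $ j" by (auto simp: vec_eq_iff)
    with less.prems have "j \<noteq> i" by auto
    define s where "s = sgn (x $ j - z $ j)"
    have s: "\<bar>s\<bar> = 1" using j by (auto simp: s_def sgn_if)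
    have "\<bar>z $ j + s - x $ j\<bar> < \<bar>z $ j - x $ j\<bar>" and b: "\<bar>z $ j + s\<bar> \<le> k"
      using j less.prems(2)[OF \<open>j \<noteq> i\<close>] x(3)[OF \<open>j \<noteq> i\<close>] by (auto simp: s_def sgn_if)
    then have "(\<Sum>l\<in>UNIV. \<bar>(z + axis j s) $ l - x $ l\<bar>) < (\<Sum>l\<in>UNIV. \<bar>z $ l - x $ l\<bar>)"
      by (intro sum_strict_mono_ex1) (auto simp: axis_def)
    moreover have "0 \<le> (\<Sum>l\<in>UNIV. \<bar>(z + axis j s) $ l - x $ l\<bar>)" by (simp add: sum_nonneg)
    ultimately have "nat (\<Sum>l\<in>UNIV. \<bar>(z + axis j s) $ l - x $ l\<bar>) < nat (\<Sum>l\<in>UNIV. \<bar>z $ l - x $ l\<bar>)"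
      by linarith
    then have 1: "z + axis j s \<in> S"
      by (rule less.hyps) (use less.prems \<open>j \<noteq> i\<close> b in \<open>auto simp: axis_def\<close>)
    define t where "t = - sgn (z $ i)"
    have t: "\<bar>t\<bar> = 1" "\<bar>z $ i + t\<bar> = k"
      using x(2) less.prems(1) \<open>0 \<le> k\<close> by (auto simp: t_def sgn_if)
    have 2: "z + axis i t \<in> S"
      by (rule cube) (use t less.prems(2) in \<open>auto simp: sup_norm_le_iff axis_def\<close>)
    have "z + axis j s \<noteq> z + axis i t" using s \<open>j \<noteq> i\<close> by (auto simp: axis_eq_axis)
    then show ?thesis
      using closed[OF nearest_neighbor_axis nearest_neighbor_axis _ 1 2] s t by blast
  qed (use x in simp)
qed

text \<open>A swap carries axis \<open>m\<close> to axis \<open>i\<close>, and a flip corrects the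
  sign; the result lies on the face already filled.\<close>

lemma fill_all_faces:
  assumes cube: "\<And>x. sup_norm x \<le> k \<Longrightarrow> x \<in> S"
    and x: "x \<in> S" "\<bar>x $ i\<bar> = k + 1" "\<And>j. j \<noteq> i \<Longrightarrow> \<bar>x $ j\<bar> \<le> k" and "0 \<le> k"
    and z: "\<bar>z $ m\<bar> = k + 1" "\<And>j. j \<noteq> m \<Longrightarrow> \<bar>z $ j\<bar> \<le> k"
  shows "z \<in> S"
proof -
  define y where "y = swap_coords i m z"
  have yi: "y $ i = z $ m" by (simp add: y_def swap_coords_def)
  have yj: "\<bar>y $ j\<bar> \<le> k" if "j \<noteq> i" for j
    using that z(2) by (auto simp: y_def swap_coords_def Transposition.transpose_def)
  have "y \<in> S"
  proof (cases "y $ i = x $ i")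
    case True
    then show ?thesis using fill_face[OF cube x \<open>0 \<le> k\<close>, of y] yj by blast
  next
    case False
    then have "flip i y $ i = x $ i" using yi z(1) x(2) by (auto simp: flip_def)
    then have "flip i y \<in> S"
      using fill_face[OF cube x \<open>0 \<le> k\<close>, of "flip i y"] yj by (auto simp: flip_def)
    from flip[OF this, of i] show ?thesis by simp
  qed
  from swap[OF this, of i m] show ?thesis by (simp add: y_def)
qed

text \<open>Induction on the number of coordinates of absolute value \<open>k + 1\<close>. If there
  are two, stepping inward along each gives two neighbors with fewer of them; with one the site is
  on a face, with none in the cube.\<close>

lemma fill_shell:
  assumes cube: "\<And>x. sup_norm x \<le> k \<Longrightarrow> x \<in> S"
    and x: "x \<in> S" "\<bar>x $ i\<bar> = k + 1" "\<And>j. j \<noteq> i \<Longrightarrow> \<bar>x $ j\<bar> \<le> k" and "0 \<le> k"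
    and z: "sup_norm z \<le> k + 1"
  shows "z \<in> S"
  using z
proof (induction "card {j. \<bar>z $ j\<bar> = k + 1}" arbitrary: z rule: less_induct)
  case less
  then have z: "\<bar>z $ j\<bar> \<le> k + 1" for j by (simp add: sup_norm_le_iff)
  show ?case
  proof (cases "\<exists>i j. i \<noteq> j \<and> \<bar>z $ i\<bar> = k + 1 \<and> \<bar>z $ j\<bar> = k + 1")
    case True
    then obtain i j where ij: "i \<noteq> j" "\<bar>z $ i\<bar> = k + 1" "\<bar>z $ j\<bar> = k + 1" by blast
    have inward: "z + axis l (- sgn (z $ l)) \<in> S \<and> \<bar>- sgn (z $ l)\<bar> = 1" if "\<bar>z $ l\<bar> = k + 1" for l
    proof
      let ?y = "z + axis l (- sgn (z $ l))"
      have "\<bar>?y $ l\<bar> = k" using that \<open>0 \<le> k\<close> by (auto simp: axis_def sgn_if)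
      moreover have "?y $ m = z $ m" if "m \<noteq> l" for m using that by (simp add: axis_def)
      ultimately have *: "\<bar>?y $ m\<bar> = (if m = l then k else \<bar>z $ m\<bar>)" for m by simp
      then have "{m. \<bar>?y $ m\<bar> = k + 1} \<subseteq> {m. \<bar>z $ m\<bar> = k + 1}"
        and "l \<notin> {m. \<bar>?y $ m\<bar> = k + 1}" and "sup_norm ?y \<le> k + 1"
        using z by (auto simp only: sup_norm_le_iff split: if_splits)
      moreover have "l \<in> {m. \<bar>z $ m\<bar> = k + 1}" using that by simp
      ultimately have "{m. \<bar>?y $ m\<bar> = k + 1} \<subset> {m. \<bar>z $ m\<bar> = k + 1}" and y: "sup_norm ?y \<le> k + 1"
        by blast+
      from psubset_card_mono[OF finite this(1)] show "?y \<in> S" by (rule less.hyps) (rule y)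
      show "\<bar>- sgn (z $ l)\<bar> = 1" using that \<open>0 \<le> k\<close> by (auto simp: sgn_if)
    qed
    \<comment> \<open>Zero multiples of different axis vectors coincide, so the two neighbors are
      distinct only because the sign is nonzero.\<close>
    have "- sgn (z $ i) \<noteq> 0" using inward[OF ij(2)] by linarith
    then have "z + axis i (- sgn (z $ i)) \<noteq> z + axis j (- sgn (z $ j))"
      using ij(1) by (simp add: axis_eq_axis)
    with inward[OF ij(2)] inward[OF ij(3)] show ?thesis
      using closed[OF nearest_neighbor_axis nearest_neighbor_axis] by blast
  next
    case False
    show ?thesis
    proof (cases "\<exists>m. \<bar>z $ m\<bar> = k + 1")
      case True
      then obtain m where m: "\<bar>z $ m\<bar> = k + 1" by blast
      then have "\<bar>z $ j\<bar> \<le> k" if "j \<noteq> m" for j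
        using False that z[of j] m by (metis linorder_not_less order.strict_iff_order zless_imp_add1_zle)
      then show ?thesis using fill_all_faces[OF cube x \<open>0 \<le> k\<close> m] by blast
    next
      case False
      then have "\<bar>z $ j\<bar> \<noteq> k + 1" for j by blast
      with z have "\<bar>z $ j\<bar> < k + 1" for j using order_less_le by blast
      then have "sup_norm z \<le> k" by (simp add: sup_norm_le_iff)
      then show ?thesis by (rule cube)
    qed
  qed
qed

text \<open>The neighbor \<open>y\<close> one level lower ensures that \<open>x\<close> has a single
  extremal coordinate, that is, lies inside a face as \<open>fill_shell\<close> demands.\<close>

lemma sup_norm_ball_subset:
  assumes "0 \<in> S"
    and step: "\<And>m. m < k \<Longrightarrow> \<exists>x\<in>S. \<exists>y. nearest_neighbor x y \<and> sup_norm x = int m + 1 \<and> sup_norm y = int m"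
  shows "sup_norm z \<le> int k \<Longrightarrow> z \<in> S"
  using step
proof (induction k arbitrary: z)
  case 0
  then show ?case using \<open>0 \<in> S\<close> by (simp add: sup_norm_le_0_iff)
next
  case (Suc k)
  then obtain x y where xy: "x \<in> S" "nearest_neighbor y x" "sup_norm x = int k + 1" "sup_norm y = int k"
    by (metis lessI nearest_neighbor_sym)
  then obtain i s where s: "\<bar>s\<bar> = 1" "x = y + axis i s"
    unfolding nearest_neighbor_iff by (metis abs_1 abs_minus_cancel empty_iff insert_iff)
  have y: "\<bar>y $ j\<bar> \<le> int k" for j using component_le_sup_norm[of y j] xy by simp
  then have xj: "\<bar>x $ j\<bar> \<le> int k" if "j \<noteq> i" for j using that s by (simp add: axis_def)
  then have "\<bar>x $ i\<bar> = int k + 1"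
    using sup_norm_attained[of x] xy(3) by (metis add.commute add_le_same_cancel2 not_one_le_zero)
  from fill_shell[OF _ xy(1) this xj] Suc show ?case by simp
qed

end

section \<open>The toppled set\<close>

text \<open>Connectedness in the form needed for filling cubes. Only the origin can be unstable at
  the start, so any other site topples only after a neighbor and inherits the level crossings of
  that neighbor.\<close>

lemma toppled_set_connected:
  fixes c :: "('d::finite) config"
  assumes "h \<le> 2 * int CARD('d) - 1" and "legal_toppling\<^sup>*\<^sup>* (initial_config h n) c"
  shows "\<forall>x. snd c x > 0 \<longrightarrow> snd c 0 > 0 \<and>
           (\<forall>k. 0 \<le> k \<and> k < sup_norm x \<longrightarrow> (\<exists>x y. snd c x > 0 \<and> nearest_neighbor x y
               \<and> sup_norm x = k + 1 \<and> sup_norm y = k))"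
  using assms(2)
proof (induction rule: rtranclp_induct)
  case base
  then show ?case by (simp add: initial_config_def)
next
  case (step c c')
  obtain z where z: "c' = topple z c" "fst c z \<ge> 2 * int CARD('d)"
    using step.hyps by (auto simp: legal_toppling_iff)
  have inv: "fst c z = fst (initial_config h n) z + laplacian (snd c) z" "\<And>x. 0 \<le> snd c x"
    using reachable_invariant[of "fst (initial_config h n)" c, folded initial_config_eq] step.hyps(1)
    by simp_all
  have T': "snd c' x > 0 \<longleftrightarrow> x = z \<or> snd c x > 0" for x
    using inv(2)[of z] z(1) by (auto simp: topple_def)
  have new: "snd c' 0 > 0 \<and> (\<forall>k. 0 \<le> k \<and> k < sup_norm z \<longrightarrow> (\<exists>x y. snd c' x > 0 \<and> nearest_neighbor x y
               \<and> sup_norm x = k + 1 \<and> sup_norm y = k))"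
  proof (cases "z = 0")
    case True
    then have "\<not> (0 \<le> k \<and> k < sup_norm z)" for k by simp
    with True show ?thesis using T' by blast
  next
    case False
    then have "laplacian (snd c) z > 0"
      using inv(1) z(2) assms(1) by (simp add: initial_config_def)
    then have "(\<Sum>y | nearest_neighbor z y. snd c y) > 0"
      using mult_nonneg_nonneg[OF of_nat_0_le_iff inv(2)[of z], of "2 * CARD('d)"]
      by (simp add: laplacian_def)
    then obtain y where y: "nearest_neighbor z y" "snd c y > 0"
      by (metis (mono_tags, lifting) linorder_not_less mem_Collect_eq sum_nonpos)
    show ?thesis
    proof (intro conjI allI impI)
      show "snd c' 0 > 0" using step.IH y T' by blast
      fix k assume k: "0 \<le> k \<and> k < sup_norm z"
      show "\<exists>x y. snd c' x > 0 \<and> nearest_neighbor x y \<and> sup_norm x = k + 1 \<and> sup_norm y = k"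
      proof (cases "k < sup_norm y")
        case True
        then show ?thesis using step.IH y k T' by blast
      next
        case False
        \<comment> \<open>Norms of neighbors differ by at most one, so the only level not inherited
          from \<open>y\<close> is crossed by \<open>z\<close> itself.\<close>
        then have "sup_norm z = k + 1 \<and> sup_norm y = k"
          using sup_norm_neighbor[OF y(1)] k by linarith
        then show ?thesis using y T' by blast
      qed
    qed
  qed
  then show ?case using step.IH T' by metis
qed

text \<open>Symmetry comes from that of the initial heights. An untoppled site other than the origin
  with two toppled neighbors would hold at least h + 2 = 2d particles and be unstable.\<close>

lemma toppled_set_symmetric_closed:
  assumes "h = 2 * int CARD('d::finite) - 2" and pos: "final_topplings h n (0 :: int ^ 'd) > 0"
  shows "symmetric_closed_set {x :: int ^ 'd. final_topplings h n x > 0}"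
proof
  let ?c = "final_config h n :: 'd config" and ?T = "final_topplings h n :: int ^ 'd \<Rightarrow> int"
  have reach: "legal_toppling\<^sup>*\<^sup>* (fst (initial_config h n), \<lambda>_. 0) ?c"
    unfolding initial_config_eq[symmetric] by (rule final_config_reachable[OF assms(1)])
  note st = final_config_stable[OF assms(1), of n]
  note inv = reachable_invariant[OF reach]
  show "flip i x \<in> {x. ?T x > 0}" if "x \<in> {x. ?T x > 0}" for i x
  proof -
    have "flip i y = 0 \<longleftrightarrow> y = 0" for y by (auto simp: flip_def vec_eq_iff)
    then show ?thesis
      using that topplings_involution[OF reach st, of "flip i" x]
      by (simp add: nearest_neighbor_flip initial_config_def final_topplings_def)
  qed
  show "swap_coords i j x \<in> {x. ?T x > 0}" if "x \<in> {x. ?T x > 0}" for i j x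
  proof -
    have "swap_coords i j y = 0 \<longleftrightarrow> y = 0" for y
    proof
      assume "swap_coords i j y = 0"
      then have "y = swap_coords i j 0" by (metis swap_coords_swap_coords)
      then show "y = 0" by (simp add: swap_coords_def vec_eq_iff)
    qed (simp add: swap_coords_def vec_eq_iff)
    then show ?thesis
      using that topplings_involution[OF reach st, of "swap_coords i j" x]
      by (simp add: nearest_neighbor_swap_coords initial_config_def final_topplings_def)
  qed
  fix x y z
  assume yz: "nearest_neighbor x y" "nearest_neighbor x z" "y \<noteq> z"
    "y \<in> {x. ?T x > 0}" "z \<in> {x. ?T x > 0}"
  show "x \<in> {x. ?T x > 0}"
  proof (rule ccontr)
    assume "x \<notin> {x. ?T x > 0}"
    with inv have T0: "?T x = 0" by (auto simp: final_topplings_def intro: antisym)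
    with pos have "x \<noteq> 0" by auto
    have "2 \<le> sum ?T {y, z}" using yz by simp
    also have "\<dots> \<le> (\<Sum>y | nearest_neighbor x y. ?T y)"
      by (rule sum_mono2) (use yz inv in \<open>auto simp: final_topplings_def\<close>)
    also have "\<dots> = laplacian ?T x" by (simp add: laplacian_def T0)
    finally have "fst ?c x \<ge> h + 2"
      using inv \<open>x \<noteq> 0\<close> by (simp add: initial_config_def final_topplings_def)
    moreover have "fst ?c x \<le> 2 * int CARD('d) - 1" using st by (simp add: stable_def)
    ultimately show False using assms by simp
  qed
qed

section \<open>From toppled sites to unions of cubes\<close>

text \<open>Closed unit cubes share faces, but each contains no lattice point except its center;
  exterior boundaries can thus be computed on sites.\<close>

lemma lattice_point_in_Union_unit_cube:
  "lattice_point x \<in> (\<Union>y\<in>A. unit_cube y) \<longleftrightarrow> x \<in> A"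
proof -
  have "lattice_point x \<in> unit_cube y \<longleftrightarrow> x = y" for x y :: "int ^ 'd"
  proof
    assume *: "lattice_point x \<in> unit_cube y"
    have "x $ i = y $ i" for i
    proof -
      have "\<bar>real_of_int (x $ i - y $ i)\<bar> \<le> 1/2"
        using * by (auto simp: lattice_point_def unit_cube_def abs_le_iff dest!: spec[of _ i])
      then show ?thesis by linarith
    qed
    then show "x = y" by (simp add: vec_eq_iff)
  qed (simp add: lattice_point_def unit_cube_def)
  then show ?thesis by auto
qed

lemma final_particles_eq:
  fixes x :: "int ^ 'd::finite"
  assumes "h = 2 * int CARD('d) - 2"
  shows "final_particles h n x
    = (if x = 0 then int n else h) + laplacian (final_topplings h n) x"
    and "0 \<le> final_topplings h n x"
    and "final_particles h n x \<le> h + 1"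
proof -
  have "legal_toppling\<^sup>*\<^sup>* (fst (initial_config h n), \<lambda>_. 0) (final_config h n :: 'd config)"
    unfolding initial_config_eq[symmetric] by (rule final_config_reachable[OF assms])
  note inv = reachable_invariant[OF this]
  then show "final_particles h n x
    = (if x = 0 then int n else h) + laplacian (final_topplings h n) x"
    "0 \<le> final_topplings h n x"
    by (auto simp: final_particles_def final_topplings_def initial_config_def)
  show "final_particles h n x \<le> h + 1"
    using final_config_stable[OF assms, of n] assms by (simp add: stable_def final_particles_def)
qed

text \<open>Since the origin toppled, an untoppled site started with h particles and gained one for
  each toppling of a neighbor.\<close>

lemma particle_cluster_eq:
  assumes h: "h = 2 * int CARD('d::finite) - 2"
    and pos: "final_topplings h n (0 :: int ^ 'd) > 0"
  shows "particle_cluster h n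
    = (toppling_cluster h n :: (real ^ 'd) set) \<union> exterior_boundary (toppling_cluster h n)"
proof -
  let ?T = "final_topplings h n :: int ^ 'd \<Rightarrow> int"
  let ?S = "{x. ?T x > 0}"
  have "final_particles h n x > h \<longleftrightarrow> (\<exists>y. nearest_neighbor x y \<and> y \<in> ?S)" if "x \<notin> ?S" for x
  proof -
    have "?T x = 0" "x \<noteq> 0" using that pos final_particles_eq(2)[OF h, of n x] by auto
    then have "final_particles h n x > h \<longleftrightarrow> (\<Sum>y | nearest_neighbor x y. ?T y) > 0"
      by (simp add: final_particles_eq(1)[OF h] laplacian_def)
    also have "\<dots> \<longleftrightarrow> (\<Sum>y | nearest_neighbor x y. ?T y) \<noteq> 0"
      using sum_nonneg[of "{y. nearest_neighbor x y}" ?T] final_particles_eq(2)[OF h, of n] by force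
    also have "\<dots> \<longleftrightarrow> (\<exists>y. nearest_neighbor x y \<and> ?T y \<noteq> 0)"
      by (subst sum_nonneg_eq_0_iff) (auto simp: final_particles_eq(2)[OF h])
    also have "\<dots> \<longleftrightarrow> (\<exists>y. nearest_neighbor x y \<and> y \<in> ?S)"
      using final_particles_eq(2)[OF h, of n] by (metis mem_Collect_eq order_less_le)
    finally show ?thesis .
  qed
  then have "?S \<union> {x. final_particles h n x > h}
      = ?S \<union> {x. x \<notin> ?S \<and> (\<exists>y. nearest_neighbor x y \<and> y \<in> ?S)}" by blast
  then have "(\<Union>x\<in>?S \<union> {x. final_particles h n x > h}. unit_cube x)
      = (\<Union>x\<in>?S \<union> {x. x \<notin> ?S \<and> (\<exists>y. nearest_neighbor x y \<and> y \<in> ?S)}. unit_cube x)"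
    by (rule arg_cong)
  then show ?thesis
    unfolding particle_cluster_def toppling_cluster_def exterior_boundary_def
      lattice_point_in_Union_unit_cube by (simp only: UN_Un)
qed

section \<open>Particle count for the lower bound\<close>

text \<open>For h = 2d - 2 this makes h smaller than the number 2^d of corners; as 2d - 1 \<le> 2^d
  it also settles the case without topplings.\<close>

lemma double_le_power2: "2 * d \<le> (2::nat) ^ d + 1"
proof (induction d)
  case (Suc d)
  have "(1::nat) \<le> 2 ^ d" by simp
  have "2 \<le> (2::nat) ^ d" if "d \<noteq> 0" using that by (cases d) simp_all
  then show ?case using Suc by (cases "d = 0") (simp_all only: power_Suc, simp_all)
qed simp

text \<open>
  For \<open>d \<ge> 2\<close> the corners of the cube of radius \<open>r + 1\<close> receive no particle; these \<open>2 ^ d\<close> sites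
  compensate for the origin starting with \<open>n\<close> rather than \<open>h + n\<close> particles.
\<close>
lemma particle_count_bound:
  assumes h: "h = 2 * int CARD('d::finite) - 2" and "0 \<le> r"
    and supp: "\<And>x :: int ^ 'd. final_topplings h n x \<noteq> 0 \<Longrightarrow> sup_norm x \<le> r"
  shows "int n \<le> (2 * r + 3) ^ CARD('d)"
proof -
  let ?T = "final_topplings h n :: int ^ 'd \<Rightarrow> int"
  let ?C = "{x :: int ^ 'd. sup_norm x \<le> r + 1}"
  define K where "K = {x :: int ^ 'd. \<forall>i. x $ i \<in> {r + 1, - (r + 1)}}"
  have card_K: "card K = 2 ^ CARD('d)"
    unfolding K_def card_vec_components_in using \<open>0 \<le> r\<close> by (simp add: numeral_2_eq_2)
  have K: "K \<subseteq> ?C" 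
  proof
    fix x assume "x \<in> K"
    then have "\<bar>x $ i\<bar> \<le> r + 1" for i using \<open>0 \<le> r\<close> by (auto simp: K_def dest!: spec[of _ i])
    then show "x \<in> ?C" by (simp add: sup_norm_le_iff)
  qed
  have fin: "finite ?C" by (rule finite_sup_norm_ball)
  have "(\<Sum>x\<in>?C. final_particles h n x - h)
      = (\<Sum>x\<in>?C. (if x = 0 then int n - h else 0) + laplacian ?T x)"
    by (rule sum.cong) (auto simp: final_particles_eq(1)[OF h])
  \<comment> \<open>Topplings within radius \<open>r\<close> send particles no farther than
    \<open>r + 1\<close>, so the total excess is the initial one, carried by the origin
    alone.\<close>
  also have "\<dots> = int n - h"
    using fin \<open>0 \<le> r\<close> sum_laplacian_eq_0[OF supp] by (simp add: sum.distrib)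
  finally have total: "(\<Sum>x\<in>?C. final_particles h n x - h) = int n - h" .
  have le1: "final_particles h n x - h \<le> 1" for x :: "int ^ 'd"
    using final_particles_eq(3)[OF h, of n x] by simp
  have card_C: "int (card ?C) = (2 * r + 3) ^ CARD('d)"
    using card_sup_norm_ball[of "r + 1", where 'd = 'd] \<open>0 \<le> r\<close> by (simp add: algebra_simps)
  show ?thesis
  \<comment> \<open>In dimension one the end points can receive particles, but the background is 0
    and an excess of at most one per site suffices.\<close>
  proof (cases "CARD('d) = 1")
    case True
    then have "h = 0" using h by simp
    moreover have "(\<Sum>x\<in>?C. final_particles h n x - h) \<le> (\<Sum>x\<in>?C. 1)" by (rule sum_mono[OF le1])
    ultimately show ?thesis using total card_C by simp
  next
    case False
    have corner: "final_particles h n x - h = 0" if "x \<in> K" for x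
    proof -
      have "x $ i = r + 1 \<or> x $ i = - (r + 1)" for i using that unfolding K_def by blast
      then have far: "\<bar>x $ i\<bar> = r + 1" for i using \<open>0 \<le> r\<close> by (metis abs_minus_cancel abs_of_nonneg add_increasing2 zero_le_one)
      have T0: "?T y = 0" if "\<bar>y $ i\<bar> = r + 1" for y i
        using supp[of y] that component_le_sup_norm[of y i] by linarith
      have "?T y = 0" if nn: "nearest_neighbor x y" for y
      proof -
        obtain i s where y: "y = x + axis i s" using nn by (auto simp: nearest_neighbor_iff)
        \<comment> \<open>Dimension at least two gives a coordinate \<open>j\<close> that a move
          along \<open>i\<close> leaves at absolute value \<open>r + 1\<close>, so no neighbor of a
          corner topples.\<close>
        have "UNIV \<noteq> {i}" using False card_1_singleton_iff[of "UNIV :: 'd set"] by auto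
        then obtain j where "j \<noteq> i" by blast
        then have "y $ j = x $ j" by (simp add: y axis_def)
        then show ?thesis using T0[of y j] far by simp
      qed
      moreover have "x \<noteq> 0" using far \<open>0 \<le> r\<close> by auto
      ultimately show ?thesis
        using T0[OF far] by (simp add: final_particles_eq(1)[OF h] laplacian_def)
    qed
    \<comment> \<open>Corners have excess 0 and other sites at most 1, which takes 2^d off the
      number of sites.\<close>
    have "(\<Sum>x\<in>?C. final_particles h n x - h)
        = (\<Sum>x\<in>?C - K. final_particles h n x - h)"
      by (rule sum.mono_neutral_right) (use fin K corner in auto)
    also have "\<dots> \<le> (\<Sum>x\<in>?C - K. 1)" by (rule sum_mono[OF le1])
    also have "\<dots> = int (card ?C) - int (card K)"
      using K fin by (simp add: card_Diff_subset finite_subset of_nat_diff card_mono)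
    finally have "int n \<le> h + (2 * r + 3) ^ CARD('d) - 2 ^ CARD('d)"
      using total card_C card_K by simp
    moreover have "2 * int CARD('d) \<le> 2 ^ CARD('d) + 1"
      using of_nat_mono[OF double_le_power2[of "CARD('d)"], where 'a = int] by simp
    ultimately show ?thesis using h by linarith
  qed
qed

section \<open>The radius of the clusters\<close>

text \<open>The radius is the largest norm of a toppled site. Connectedness supplies a crossing of
  each lower level, so filling reaches this radius.\<close>

lemma toppled_set_eq_cube:
  assumes h: "h = 2 * int CARD('d::finite) - 2"
    and ex: "\<exists>x :: int ^ 'd. final_topplings h n x > 0"
  shows "\<exists>r. 0 \<le> r \<and> r \<le> int n \<and> {x :: int ^ 'd. final_topplings h n x > 0} = {x. sup_norm x \<le> r}"
proof -
  let ?T = "final_topplings h n :: int ^ 'd \<Rightarrow> int"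
  let ?S = "{x. ?T x > 0}"
  have conn: "\<forall>x. ?T x > 0 \<longrightarrow> ?T 0 > 0 \<and>
           (\<forall>k. 0 \<le> k \<and> k < sup_norm x \<longrightarrow> (\<exists>x y. ?T x > 0 \<and> nearest_neighbor x y
               \<and> sup_norm x = k + 1 \<and> sup_norm y = k))"
    using toppled_set_connected[OF _ final_config_reachable[OF h]] h by (simp add: final_topplings_def)
  with ex have pos: "?T 0 > 0" by blast
  have "sup_norm x \<le> int n" if "?T x > 0" for x
    using final_topplings_le[OF h, of n x] pyramid_eq_0[of n "sup_norm x"] that by linarith
  then have S: "?S \<subseteq> {x. sup_norm x \<le> int n}" by blast
  then have fin: "finite ?S" using finite_sup_norm_ball finite_subset by blast
  define r where "r = Max (sup_norm ` ?S)"
  have "r \<in> sup_norm ` ?S" unfolding r_def using fin pos by (intro Max_in) auto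
  then obtain x where x: "?T x > 0" "sup_norm x = r" by auto
  interpret symmetric_closed_set ?S by (rule toppled_set_symmetric_closed[OF h pos])
  have "0 \<le> r" using x sup_norm_nonneg by auto
  have "sup_norm z \<le> r \<Longrightarrow> z \<in> ?S" for z
  proof (rule sup_norm_ball_subset[of "nat r"])
    fix m assume "m < nat r"
    then have "0 \<le> int m \<and> int m < sup_norm x" using x by linarith
    with conn x(1) show "\<exists>x\<in>?S. \<exists>y. nearest_neighbor x y \<and> sup_norm x = int m + 1 \<and> sup_norm y = int m"
      by blast
  qed (use pos \<open>0 \<le> r\<close> in auto)
  moreover have "sup_norm z \<le> r" if "z \<in> ?S" for z
    unfolding r_def using fin that by (intro Max_ge) auto
  ultimately have "?S = {x. sup_norm x \<le> r}" by blast
  moreover have "r \<le> int n" using S x by auto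
  ultimately show ?thesis using \<open>0 \<le> r\<close> by blast
qed

text \<open>A negative radius stands for an empty toppling cluster. For n = 2d - 1 the origin is
  stable with h + 1 particles, so the particle cluster is one unit cube although nothing topples;
  this value is a genuine exception.\<close>

lemma cluster_radius:
  assumes h: "h = 2 * int CARD('d::finite) - 2"
  shows "\<exists>r. (toppling_cluster h n :: (real ^ 'd) set) = lattice_cube r \<and>
           (n \<noteq> 2 * CARD('d) - 1 \<longrightarrow>
             (particle_cluster h n :: (real ^ 'd) set)
               = lattice_cube r \<union> exterior_boundary (lattice_cube r)) \<and>
           (0 \<le> r \<longrightarrow> r \<in> \<int>) \<and>
           1/2 * root CARD('d) (real n) - 3/2 \<le> r \<and> r \<le> real n"
proof (cases "\<exists>x :: int ^ 'd. final_topplings h n x > 0")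
  case True
  from toppled_set_eq_cube[OF h True] obtain r where r: "0 \<le> r" "r \<le> int n"
    and S: "{x :: int ^ 'd. final_topplings h n x > 0} = {x. sup_norm x \<le> r}" by blast
  have "(0 :: int ^ 'd) \<in> {x. sup_norm x \<le> r}" using r by simp
  then have pos: "final_topplings h n (0 :: int ^ 'd) > 0" using S by blast
  have cube: "(toppling_cluster h n :: (real ^ 'd) set) = lattice_cube (real_of_int r)"
    unfolding toppling_cluster_def lattice_cube_def S by (simp add: sup_norm_def)
  have "int n \<le> (2 * r + 3) ^ CARD('d)"
    using S final_particles_eq(2)[OF h, of n] r(1)
    by (intro particle_count_bound[OF h]) (auto simp: order_less_le)
  then have "real n \<le> (2 * real_of_int r + 3) ^ CARD('d)"
    by (metis (mono_tags, lifting) of_int_add of_int_le_iff of_int_mult of_int_numeral of_int_of_nat_eq of_int_power)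
  then have "root CARD('d) (real n) \<le> root CARD('d) ((2 * real_of_int r + 3) ^ CARD('d))"
    by (intro real_root_le_mono) auto
  also have "\<dots> = 2 * real_of_int r + 3" using r by (intro real_root_power_cancel) auto
  finally have "1/2 * root CARD('d) (real n) - 3/2 \<le> real_of_int r" by simp
  with cube particle_cluster_eq[OF h pos] r show ?thesis
    by (intro exI[of _ "real_of_int r"]) auto
next
  case False
  then have T0: "final_topplings h n = (\<lambda>x :: int ^ 'd. 0)"
    using final_particles_eq(2)[OF h, of n] by (auto simp: fun_eq_iff order_less_le)
  have H: "final_particles h n x = (if x = 0 then int n else h)" for x :: "int ^ 'd"
    by (simp add: final_particles_eq(1)[OF h] T0 laplacian_def)
  have n: "int n \<le> h + 1" using final_particles_eq(3)[OF h, of n 0] H[of 0] by simp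
  \<comment> \<open>The value -1/2 is negative and equals 1/2 * 2 - 3/2, the most that the lower
    bound can ask when n \<le> 2^d.\<close>
  have empty: "(lattice_cube (-1/2) :: (real ^ 'd) set) = {}"
  proof -
    have "\<not> real_of_int (sup_norm x) \<le> -1/2" for x :: "int ^ 'd"
      using sup_norm_nonneg[of x] by linarith
    then show ?thesis by (auto simp: lattice_cube_def sup_norm_def)
  qed
  have tc: "(toppling_cluster h n :: (real ^ 'd) set) = {}"
    by (simp add: toppling_cluster_def T0)
  have pc: "(particle_cluster h n :: (real ^ 'd) set) = {}" if "n \<noteq> 2 * CARD('d) - 1"
  proof -
    have "int n \<le> h" using that n h by linarith
    then have "{x :: int ^ 'd. final_particles h n x > h} = {}" by (auto simp: H)
    then show ?thesis by (simp only: particle_cluster_def tc) simp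
  qed
  have "n \<le> 2 ^ CARD('d)" using n h double_le_power2[of "CARD('d)"] by linarith
  then have "real n \<le> 2 ^ CARD('d)" by (metis of_nat_le_iff of_nat_numeral of_nat_power)
  then have "root CARD('d) (real n) \<le> root CARD('d) (2 ^ CARD('d))"
    by (intro real_root_le_mono) auto
  then have "root CARD('d) (real n) \<le> 2" by (simp add: real_root_power_cancel)
  with empty tc pc show ?thesis
    by (intro exI[of _ "-1/2"]) (auto simp: exterior_boundary_def)
qed

theorem theorem4p1:
  fixes h :: int
  assumes "h = 2 * int CARD('d::finite) - 2"
  shows "\<exists>r :: nat \<Rightarrow> real. \<forall>n.
           (toppling_cluster h n :: (real ^ 'd) set) = lattice_cube (r n) \<and>
           (n \<noteq> 2 * CARD('d) - 1 \<longrightarrow>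
             (particle_cluster h n :: (real ^ 'd) set)
               = lattice_cube (r n) \<union> exterior_boundary (lattice_cube (r n))) \<and>
           (0 \<le> r n \<longrightarrow> r n \<in> \<int>) \<and>
           1/2 * root CARD('d) (real n) - 3/2 \<le> r n \<and> r n \<le> real n"
  by (intro choice allI cluster_radius[OF assms])

end
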